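(* Let $q$ and $a$ be positive integers with $\gcd(a,q)=1$, and let $\nu$ be a probability measure supported on the set $\mathbb{T}_q=\{b/q : b\in\{1,\dots,q\}\}\subset\mathbb{T}$. Then $\nu$ can be represented at $\frac{a}{q}$, that is, there is a good set $S\subset\mathbb{N}$ such that $\mu_{S,\frac{a}{q}}=\nu$.
   Context: $\mathbb{N}=\{1,2,3,\dots\}$ and $\mathbb{T}=\mathbb{R}/\mathbb{Z}$. Write $e(\beta)=e^{2\pi i\beta}$. A good set $S\subset\mathbb{N}$ is an infinite set of positive integers which, when listed in increasing order as $s_1<s_2<\dots$, has the property that $\lim_{N\to\infty}\frac1N\sum_{n=1}^N e(s_n\alpha)$ exists for every real number $\alpha$. For a good set $S$, the weak limit of probability measures $\mu_{S,\alpha}:=\lim_{N\to\infty}\frac1N\sum_{n=1}^N\delta_{s_n\alpha}$ on $\mathbb{T}$ exists for every $\alpha\in\mathbb{T}$ (here $s_n\alpha$ is taken mod $1$). A good set $S$ represents a Borel probability measure $\nu$ on $\mathbb{T}$ at $\alpha$ if $\mu_{S,\alpha}=\nu$. *)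

theory Defs
  imports "HOL-Probability.Probability"
begin

section \<open>The circle \<open>\<real>/\<int>\<close> with the quotient topology\<close>

quotient_type circle = real / "\<lambda>x y. x - y \<in> \<int>"
proof (rule equivpI)
  show "reflp (\<lambda>x y::real. x - y \<in> \<int>)"
    by (simp add: reflp_def)
  show "symp (\<lambda>x y::real. x - y \<in> \<int>)"
  proof (rule sympI)
    fix x y :: real assume "x - y \<in> \<int>"
    from Ints_minus [OF this] show "y - x \<in> \<int>" by simp
  qed
  show "transp (\<lambda>x y::real. x - y \<in> \<int>)"
  proof (rule transpI)
    fix x y z :: real assume "x - y \<in> \<int>" "y - z \<in> \<int>"
    from Ints_add [OF this] show "x - z \<in> \<int>" by simp
  qed
qed

lift_definition mod1 :: "real \<Rightarrow> circle" is "\<lambda>x. x" .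

lemma mod1_eq_iff: "mod1 x = mod1 y \<longleftrightarrow> x - y \<in> \<int>"
  by transfer simp

lemma surj_mod1: "\<exists>x. y = mod1 x"
  by transfer (metis Ints_0 diff_self)

instantiation circle :: topological_space
begin

definition open_circle :: "circle set \<Rightarrow> bool"
  where "open_circle U \<longleftrightarrow> open (mod1 -` U)"

instance
proof
  show "open (UNIV :: circle set)"
    by (simp add: open_circle_def)
  show "open (U \<inter> V)" if "open U" "open V" for U V :: "circle set"
    using that by (simp add: open_circle_def open_Int)
  show "open (\<Union>K)" if "\<forall>U\<in>K. open U" for K :: "circle set set"
    using that by (simp add: open_circle_def vimage_Union open_UN)
qed

end

lemma continuous_on_mod1: "continuous_on UNIV mod1"
  by (simp add: continuous_on_open_vimage open_circle_def)

section \<open>Good sets and the measures they represent\<close>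

definition e :: "real \<Rightarrow> complex"
  where "e \<beta> = exp (2 * of_real pi * \<i> * of_real \<beta>)"

text \<open>
  The sequence \<open>enumerate S\<close> lists the infinite set \<open>S\<close> in increasing order,
  starting at index \<open>0\<close>: the element \<open>s\<^sub>n\<close> is \<open>enumerate S (n - 1)\<close>.
\<close>

definition good_set :: "nat set \<Rightarrow> bool"
  where "good_set S \<longleftrightarrow> infinite S \<and> 0 \<notin> S \<and>
    (\<forall>\<alpha>::real. convergent (\<lambda>N. (\<Sum>n<N. e (real (enumerate S n) * \<alpha>)) / of_nat N))"

text \<open>
  The average of the point masses at the first \<open>N\<close> points \<open>s\<^sub>n \<alpha>\<close>, as the image of the
  uniform distribution on the indices; see \<open>measure_empirical\<close>.
\<close>

definition empirical :: "nat set \<Rightarrow> real \<Rightarrow> nat \<Rightarrow> circle measure"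
  where "empirical S \<alpha> N =
    distr (uniform_count_measure {..<N}) borel (\<lambda>n. mod1 (real (enumerate S n) * \<alpha>))"

lemma measure_empirical:
  assumes "A \<in> sets borel"
  shows "measure (empirical S \<alpha> N) A = (\<Sum>n<N. indicator A (mod1 (real (enumerate S n) * \<alpha>))) / real N"
proof -
  let ?f = "\<lambda>n. mod1 (real (enumerate S n) * \<alpha>)"
  have "measure (empirical S \<alpha> N) A = measure (uniform_count_measure {..<N}) (?f -` A \<inter> {..<N})"
    unfolding empirical_def using assms
    by (subst measure_distr) (auto simp: measurable_def space_uniform_count_measure)
  also have "\<dots> = card (?f -` A \<inter> {..<N}) / N"
    by (simp add: measure_uniform_count_measure)
  also have "real (card (?f -` A \<inter> {..<N})) = (\<Sum>n<N. indicator A (?f n))"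
  proof -
    have "(\<Sum>n<N. indicator A (?f n) :: real) = (\<Sum>n<N. if n \<in> ?f -` A then 1 else 0)"
      by (intro sum.cong) (auto simp: indicator_def)
    also have "\<dots> = card ({..<N} \<inter> ?f -` A)"
      by (subst sum.inter_restrict [symmetric]) auto
    finally show ?thesis by (simp add: Int_commute)
  qed
  finally show ?thesis .
qed

text \<open>
  Weak convergence of Borel probability measures on the circle. As the circle is compact,
  every continuous test function is bounded.
\<close>

definition weak_limit :: "(nat \<Rightarrow> circle measure) \<Rightarrow> circle measure \<Rightarrow> bool"
  where "weak_limit M \<mu> \<longleftrightarrow> prob_space \<mu> \<and> sets \<mu> = sets borel \<and>
    (\<forall>f :: circle \<Rightarrow> real. continuous_on UNIV f \<longrightarrow>
      (\<lambda>N. \<integral>x. f x \<partial>M N) \<longlonglongrightarrow> (\<integral>x. f x \<partial>\<mu>))"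

definition limit_measure :: "nat set \<Rightarrow> real \<Rightarrow> circle measure"
  where "limit_measure S \<alpha> = (THE \<mu>. weak_limit (empirical S \<alpha>) \<mu>)"

text \<open>
  The middle conjunct makes explicit that the weak limit exists, so that the definite description
  in \<open>limit_measure\<close> denotes it; uniqueness is \<open>weak_limit_unique\<close> below.
\<close>

definition represents :: "nat set \<Rightarrow> real \<Rightarrow> circle measure \<Rightarrow> bool"
  where "represents S \<alpha> \<nu> \<longleftrightarrow>
    good_set S \<and> (\<exists>\<mu>. weak_limit (empirical S \<alpha>) \<mu>) \<and> limit_measure S \<alpha> = \<nu>"

section \<open>Uniqueness of weak limits\<close>

lemma e_eq_iff: "e x = e y \<longleftrightarrow> x - y \<in> \<int>"
proof -
  have "e x = e y \<longleftrightarrow> (\<exists>n::int. 2 * pi * x = 2 * pi * y + 2 * of_int n * pi)"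
    unfolding e_def exp_eq by (auto simp: complex_eq_iff algebra_simps)
  also have "\<dots> \<longleftrightarrow> (\<exists>n::int. x - y = of_int n)"
  proof (intro iff_exI)
    fix n :: int
    have "2 * pi * x = 2 * pi * y + 2 * of_int n * pi \<longleftrightarrow> (2 * pi) * (x - y) = (2 * pi) * of_int n"
      by (simp add: algebra_simps)
    also have "\<dots> \<longleftrightarrow> x - y = of_int n" by (subst mult_cancel_left) simp
    finally show "2 * pi * x = 2 * pi * y + 2 * of_int n * pi \<longleftrightarrow> x - y = of_int n" .
  qed
  finally show ?thesis by (auto simp: Ints_def)
qed

lift_definition circle_e :: "circle \<Rightarrow> complex" is e
  by (simp add: e_eq_iff)

lemma circle_e_mod1: "circle_e (mod1 x) = e x"
  by transfer simp

lemma inj_circle_e: "inj circle_e"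
  by (rule injI, transfer) (simp add: e_eq_iff)

lemma continuous_on_e: "continuous_on A e"
  unfolding e_def by (intro continuous_intros)

lemma continuous_on_circle_e: "continuous_on UNIV circle_e"
proof (unfold continuous_on_open_vimage [OF open_UNIV], intro allI impI)
  fix B :: "complex set" assume "open B"
  then have "open (e -` B)"
    using continuous_on_e [of UNIV] by (simp add: continuous_on_open_vimage)
  also have "e -` B = mod1 -` circle_e -` B"
    by (auto simp: circle_e_mod1)
  finally show "open (circle_e -` B \<inter> UNIV)"
    by (simp add: open_circle_def)
qed

lemma closed_circle_e_image:
  assumes "closed C" shows "closed (circle_e ` C)"
proof -
  have "closed (mod1 -` C)"
    using assms unfolding closed_def open_circle_def by (simp add: vimage_Compl)
  then have "compact (mod1 -` C \<inter> {0..1})"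
    by (simp add: closed_Int_compact)
  then have "compact (e ` (mod1 -` C \<inter> {0..1}))"
    by (intro compact_continuous_image continuous_on_e)
  also have "e ` (mod1 -` C \<inter> {0..1}) = circle_e ` C"
  proof (intro equalityI subsetI)
    fix z assume "z \<in> circle_e ` C"
    then obtain c where c: "c \<in> C" "z = circle_e c" by blast
    obtain x where "c = mod1 x" using surj_mod1 by blast
    with c have x: "mod1 x \<in> C" "z = e x" by (simp_all add: circle_e_mod1)
    have "mod1 (frac x) = mod1 x" "e (frac x) = e x"
      by (simp_all add: mod1_eq_iff e_eq_iff frac_def)
    with x have "frac x \<in> mod1 -` C \<inter> {0..1}" "z = e (frac x)"
      by (auto simp: less_imp_le [OF frac_lt_1])
    then show "z \<in> e ` (mod1 -` C \<inter> {0..1})" by blast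
  qed (auto simp: circle_e_mod1 [symmetric])
  finally show ?thesis by (rule compact_imp_closed)
qed

lemma closed_circle_approx:
  assumes "closed C" "C \<noteq> {}" "prob_space \<mu>" and [measurable_cong]: "sets \<mu> = sets borel"
  shows "(\<lambda>n. \<integral>x. max 0 (1 - real n * infdist (circle_e x) (circle_e ` C)) \<partial>\<mu>)
           \<longlonglongrightarrow> measure \<mu> C"
proof -
  interpret prob_space \<mu> by fact
  let ?d = "\<lambda>x. infdist (circle_e x) (circle_e ` C)"
  have [measurable]: "circle_e \<in> borel_measurable borel"
    by (rule borel_measurable_continuous_onI [OF continuous_on_circle_e])
  have dm [measurable]: "?d \<in> borel_measurable borel"
    by (intro borel_measurable_continuous_onI continuous_intros continuous_on_circle_e)
  have C: "C \<in> sets \<mu>" using assms by simp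
  have sp: "space \<mu> = UNIV" using sets_eq_imp_space_eq [OF assms(4)] by simp
  have "(\<lambda>n. \<integral>x. max 0 (1 - real n * ?d x) \<partial>\<mu>) \<longlonglongrightarrow> (\<integral>x. indicator C x \<partial>\<mu>)"
  proof (rule integral_dominated_convergence [where w = "\<lambda>_. 1"])
    show "(indicator C :: circle \<Rightarrow> real) \<in> borel_measurable \<mu>"
      using C by simp
    show "AE x in \<mu>. (\<lambda>n. max 0 (1 - real n * ?d x)) \<longlonglongrightarrow> indicator C x"
    proof (rule AE_I2)
      fix x
      show "(\<lambda>n. max 0 (1 - real n * ?d x)) \<longlonglongrightarrow> indicator C x"
      proof (cases "x \<in> C")
        case True
        then have "?d x = 0" by simp
        with True show ?thesis by simp
      next
        case False
        then have "circle_e x \<notin> circle_e ` C"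
          by (simp add: inj_image_mem_iff [OF inj_circle_e])
        then have "?d x > 0"
          using closed_circle_e_image [OF assms(1)] assms(2)
          by (intro infdist_pos_not_in_closed) auto
        have "eventually (\<lambda>n. 1 / ?d x < real n) sequentially"
          using filterlim_real_sequentially unfolding filterlim_at_top_dense by blast
        then have "eventually (\<lambda>n. max 0 (1 - real n * ?d x) = indicator C x) sequentially"
          by eventually_elim (use False \<open>?d x > 0\<close> in \<open>simp add: field_simps\<close>)
        then show ?thesis by (rule tendsto_eventually)
      qed
    qed
    show "AE x in \<mu>. norm (max 0 (1 - real n * ?d x)) \<le> 1" for n
      by (rule AE_I2) (simp add: infdist_nonneg)
  qed (auto)
  then show ?thesis using C by (simp add: sp)
qed

lemma weak_limit_unique:
  assumes "weak_limit M \<mu>" "weak_limit M \<mu>'"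
  shows "\<mu> = \<mu>'"
proof -
  interpret \<mu>: prob_space \<mu> using assms by (simp add: weak_limit_def)
  interpret \<mu>': prob_space \<mu>' using assms by (simp add: weak_limit_def)
  have sets: "sets \<mu> = sets borel" "sets \<mu>' = sets borel"
    using assms by (simp_all add: weak_limit_def)
  have int: "(\<integral>x. f x \<partial>\<mu>) = (\<integral>x. f x \<partial>\<mu>')" if "continuous_on UNIV f" for f :: "circle \<Rightarrow> real"
    using assms that by (auto simp: weak_limit_def intro: LIMSEQ_unique)
  have closed: "measure \<mu> C = measure \<mu>' C" if "closed C" for C
  proof (cases "C = {}")
    case False
    have "continuous_on UNIV (\<lambda>x. max 0 (1 - real n * infdist (circle_e x) (circle_e ` C)))" for n
      by (intro continuous_intros continuous_on_circle_e)
    from int [OF this] show ?thesis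
      using closed_circle_approx [OF that False \<mu>.prob_space_axioms sets(1)]
        closed_circle_approx [OF that False \<mu>'.prob_space_axioms sets(2)]
      by (simp add: LIMSEQ_unique)
  qed simp
  have borel: "sets borel = sigma_sets UNIV (Collect closed :: circle set set)"
    by (simp add: borel_eq_closed)
  show ?thesis
  proof (rule measure_eqI_generator_eq [where E = "Collect closed" and \<Omega> = UNIV and A = "\<lambda>_. UNIV"])
    show "Int_stable (Collect closed :: circle set set)"
      by (auto simp: Int_stable_def)
    show "emeasure \<mu> X = emeasure \<mu>' X" if "X \<in> Collect closed" for X
      using closed that by (simp add: \<mu>.emeasure_eq_measure \<mu>'.emeasure_eq_measure)
  qed (auto simp: sets borel)
qed

lemma limit_measure_eqI: "weak_limit (empirical S \<alpha>) \<mu> \<Longrightarrow> limit_measure S \<alpha> = \<mu>"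
  unfolding limit_measure_def by (blast intro: weak_limit_unique)

end

theory Submission
  imports Defs "HOL-Library.Discrete_Functions" "HOL-Number_Theory.Cong" "HOL-Real_Asymp.Real_Asymp"
begin

text \<open>
  Take \<open>s\<^sub>n = q n + r\<^sub>n\<close> with labels \<open>r\<^sub>n \<in> {1..q}\<close>. This sequence is strictly increasing whatever
  the labels are, and \<open>s\<^sub>n a / q\<close> depends modulo \<open>1\<close> only on \<open>r\<^sub>n\<close>. As \<open>a\<close> is a unit modulo \<open>q\<close>, the
  points \<open>c a / q\<close> with \<open>c \<in> {1..q}\<close> run once through the fractions \<open>b / q\<close> that carry \<open>\<nu>\<close>; so the measure at \<open>a / q\<close>
  is \<open>\<nu>\<close> as soon as each label \<open>c\<close> occurs with frequency \<open>p\<^sub>c = \<nu> {c a / q}\<close>.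

  Goodness is a stronger demand, since \<open>e(s\<^sub>n \<alpha>) = z\<^sup>n e(r\<^sub>n \<alpha>)\<close> with \<open>z = e(q \<alpha>)\<close> and the averages
  have to converge for every \<open>\<alpha>\<close>. It is met by making the labels constant on long intervals: cut
  the naturals into the blocks from \<open>k\<^sup>2\<close> to \<open>(k + 1)\<^sup>2\<close>, and cut each block into \<open>q\<close> consecutive intervals,
  with the proportions \<open>p\<^sub>1, \<dots>, p\<^sub>q\<close> up to rounding, on which the label is \<open>1, \<dots>, q\<close>. If \<open>z \<noteq> 1\<close>, each
  interval contributes a geometric sum, bounded in terms of \<open>z\<close> alone. If \<open>z = 1\<close>, it contributes
  its length, which is correct up to a bounded error. In both cases the errors up to \<open>N\<close> amount to
  \<open>O(\<surd>N)\<close>, there being about \<open>\<surd>N\<close> blocks, each of length \<open>O(\<surd>N)\<close>.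

  The core is \<open>threshold_average\<close>, which treats a single initial part of every block; the labels
  are differences of such parts, whence \<open>label_average\<close>. The latter gives goodness with weights
  \<open>e(c \<alpha>)\<close> and, for \<open>z = 1\<close>, weak convergence with weights \<open>f(c a / q)\<close>.
\<close>

section \<open>Averages along blocks between consecutive squares\<close>

lemma sum_lessThan_add: "(\<Sum>n<m + l. f n) = (\<Sum>n<m. f n) + (\<Sum>j<l. f (m + j))"
  for f :: "nat \<Rightarrow> 'a::comm_monoid_add"
  by (induction l) (simp_all add: add.assoc)

lemma block_sum_bound:
  fixes f :: "nat \<Rightarrow> complex"
  assumes "\<And>k. norm (\<Sum>j<2*k+1. f (k\<^sup>2 + j)) \<le> C"
  shows "norm (\<Sum>n<k\<^sup>2. f n) \<le> C * real k"
proof (induction k)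
  case (Suc k)
  have "(\<Sum>n<(Suc k)\<^sup>2. f n) = (\<Sum>n<k\<^sup>2 + (2*k+1). f n)"
    by (rule arg_cong[of _ _ "\<lambda>N. \<Sum>n<N. f n"]) (simp add: power2_eq_square)
  also have "\<dots> = (\<Sum>n<k\<^sup>2. f n) + (\<Sum>j<2*k+1. f (k\<^sup>2 + j))"
    by (rule sum_lessThan_add)
  finally show ?case
    using Suc assms[of k] norm_triangle_ineq[of "\<Sum>n<k\<^sup>2. f n" "\<Sum>j<2*k+1. f (k\<^sup>2 + j)"]
    by (simp add: algebra_simps)
qed simp

text \<open>
  With complete blocks contributing \<open>C\<close> each, and an incomplete last block no longer than twice the
  number of complete ones, partial sums are \<open>O(\<surd>N)\<close>; the trivial bound on the last block suffices.
\<close>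

lemma block_average:
  fixes f :: "nat \<Rightarrow> complex"
  assumes M: "\<And>n. norm (f n) \<le> M" and C: "\<And>k. norm (\<Sum>j<2*k+1. f (k\<^sup>2 + j)) \<le> C"
  shows "(\<lambda>N. (\<Sum>n<N. f n) / of_nat N) \<longlonglongrightarrow> 0"
proof (rule Lim_null_comparison)
  have C0: "C \<ge> 0" using C[of 0] norm_ge_zero order_trans by blast
  have M0: "M \<ge> 0" using M[of 0] norm_ge_zero order_trans by blast
  show "eventually (\<lambda>N. norm ((\<Sum>n<N. f n) / of_nat N) \<le> (C + 2 * M) * (1 / sqrt (real N))) sequentially"
  proof (rule eventually_sequentiallyI)
    fix N :: nat assume "1 \<le> N"
    define k where "k = floor_sqrt N"
    have k1: "k\<^sup>2 \<le> N" by (simp add: k_def)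
    have k2: "N - k\<^sup>2 \<le> 2 * k"
      using Suc_floor_sqrt_power2_gt[of N] by (simp add: k_def power2_eq_square)
    have "(\<Sum>n<N. f n) = (\<Sum>n<k\<^sup>2. f n) + (\<Sum>n\<in>{k\<^sup>2..<N}. f n)"
      using k1 by (subst sum.union_disjoint[symmetric]) (auto intro!: sum.cong)
    then have "norm (\<Sum>n<N. f n) \<le> norm (\<Sum>n<k\<^sup>2. f n) + norm (\<Sum>n\<in>{k\<^sup>2..<N}. f n)"
      by (simp add: norm_triangle_ineq)
    also have "norm (\<Sum>n\<in>{k\<^sup>2..<N}. f n) \<le> real (N - k\<^sup>2) * M"
      using sum_norm_bound[of "{k\<^sup>2..<N}" f M] M by simp
    also have "\<dots> \<le> real (2 * k) * M"
      using k2 M0 by (intro mult_right_mono) linarith+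
    also have "norm (\<Sum>n<k\<^sup>2. f n) \<le> C * real k"
      by (rule block_sum_bound) (rule C)
    finally have "norm (\<Sum>n<N. f n) \<le> (C + 2 * M) * real k" by (simp add: algebra_simps)
    also have "real k \<le> sqrt (real N)"
      by (rule real_le_rsqrt) (use k1 in \<open>metis of_nat_le_iff of_nat_power\<close>)
    finally have "norm (\<Sum>n<N. f n) \<le> (C + 2 * M) * sqrt (real N)"
      using C0 M0 by (simp add: mult_left_mono)
    then have "norm ((\<Sum>n<N. f n) / of_nat N) \<le> (C + 2 * M) * sqrt (real N) / real N"
      by (simp add: norm_divide divide_right_mono)
    also have "\<dots> = (C + 2 * M) * (1 / sqrt (real N))"
      using sqrt_divide_self_eq[of "real N"] by (simp add: inverse_eq_divide flip: times_divide_eq_right)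
    finally show "norm ((\<Sum>n<N. f n) / of_nat N) \<le> (C + 2 * M) * (1 / sqrt (real N))" .
  qed
  have "(\<lambda>N. 1 / sqrt (real N)) \<longlonglongrightarrow> 0"
    by real_asymp
  from tendsto_mult_right_zero[OF this] show "(\<lambda>N. (C + 2 * M) * (1 / sqrt (real N))) \<longlonglongrightarrow> 0" .
qed

definition block_pos :: "nat \<Rightarrow> real"
  where "block_pos n = real (n - (floor_sqrt n)\<^sup>2) / real (2 * floor_sqrt n + 1)"

lemma block_pos_in_block:
  assumes "j < 2*k+1"
  shows "block_pos (k\<^sup>2 + j) = real j / real (2*k+1)"
proof -
  have "floor_sqrt (k\<^sup>2 + j) = k"
    by (rule floor_sqrt_unique) (use assms in \<open>simp_all add: power2_eq_square\<close>)
  then show ?thesis by (simp add: block_pos_def)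
qed

lemma block_pos_nonneg: "0 \<le> block_pos n"
  by (simp add: block_pos_def)

lemma block_pos_less_1: "block_pos n < 1"
proof -
  have "n - (floor_sqrt n)\<^sup>2 < 2 * floor_sqrt n + 1"
    using Suc_floor_sqrt_power2_gt[of n] by (simp add: power2_eq_square)
  then have "real (n - (floor_sqrt n)\<^sup>2) < real (2 * floor_sqrt n + 1)" by (rule of_nat_less_iff[THEN iffD2])
  then show ?thesis unfolding block_pos_def by (subst pos_divide_less_eq) simp_all
qed

text \<open>
  In each block the condition on \<open>block_pos\<close> selects an initial interval, so the block sum of the
  difference to the limit is a geometric sum or, for \<open>z = 1\<close>, a rounding error.
\<close>

lemma threshold_average:
  fixes z :: complex
  assumes z: "norm z = 1" and t: "0 \<le> t" "t \<le> 1"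
  shows "(\<lambda>N. (\<Sum>n<N. z ^ n * of_bool (block_pos n < t)) / of_nat N)
           \<longlonglongrightarrow> (if z = 1 then of_real t else 0)"
proof -
  define L :: complex where "L = (if z = 1 then of_real t else 0)"
  have "(\<lambda>N. (\<Sum>n<N. z ^ n * of_bool (block_pos n < t) - L) / of_nat N) \<longlonglongrightarrow> 0"
  proof (rule block_average)
    fix n
    show "norm (z ^ n * of_bool (block_pos n < t) - L) \<le> 2"
    proof -
      have "norm (z ^ n * of_bool (block_pos n < t)) \<le> 1" by (simp add: norm_mult norm_power z)
      moreover have "norm L \<le> 1" using t by (simp add: L_def)
      ultimately show ?thesis
        using norm_triangle_ineq4[of "z ^ n * of_bool (block_pos n < t)" L] by linarith
    qed
  next
    fix k :: nat
    \<comment> \<open>The number of positions in the block below the threshold.\<close>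
    define m where "m = nat \<lceil>t * real (2*k+1)\<rceil>"
    have m: "real j / real (2*k+1) < t \<longleftrightarrow> j < m" for j
    proof -
      have "real j / real (2*k+1) < t \<longleftrightarrow> real j < t * real (2*k+1)"
        by (rule pos_divide_less_eq) simp
      also have "\<dots> \<longleftrightarrow> int j < \<lceil>t * real (2*k+1)\<rceil>" by (simp add: less_ceiling_iff)
      also have "\<dots> \<longleftrightarrow> j < m" by (auto simp: m_def)
      finally show ?thesis .
    qed
    have "t * real (2*k+1) \<le> 1 * real (2*k+1)"
      by (rule mult_right_mono) (use t in simp_all)
    then have "\<lceil>t * real (2*k+1)\<rceil> \<le> int (2*k+1)"
      unfolding ceiling_le_iff by (simp only: of_int_of_nat_eq mult_1)
    then have mle: "m \<le> 2*k+1" by (simp only: m_def nat_le_iff)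
    have "0 \<le> t * real (2*k+1)" using t by simp
    then have "0 \<le> \<lceil>t * real (2*k+1)\<rceil>" by linarith
    then have mr: "real m = of_int \<lceil>t * real (2*k+1)\<rceil>" by (simp add: m_def)
    have mt: "\<bar>real m - t * real (2*k+1)\<bar> \<le> 1"
      unfolding mr by linarith
    have "(\<Sum>j<2*k+1. z ^ (k\<^sup>2 + j) * of_bool (block_pos (k\<^sup>2 + j) < t))
        = (\<Sum>j<2*k+1. if j < m then z ^ k\<^sup>2 * z ^ j else 0)"
    proof (intro sum.cong refl)
      fix j assume "j \<in> {..<2*k+1}"
      then have "block_pos (k\<^sup>2 + j) < t \<longleftrightarrow> j < m"
        by (simp only: block_pos_in_block m lessThan_iff)
      then show "z ^ (k\<^sup>2 + j) * of_bool (block_pos (k\<^sup>2 + j) < t) = (if j < m then z ^ k\<^sup>2 * z ^ j else 0)"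
        by (simp add: power_add)
    qed
    also have "\<dots> = (\<Sum>j\<in>{..<2*k+1} \<inter> {j. j < m}. z ^ k\<^sup>2 * z ^ j)"
      by (simp add: sum.inter_restrict)
    also have "{..<2*k+1} \<inter> {j. j < m} = {..<m}" using mle by auto
    finally have sum: "(\<Sum>j<2*k+1. z ^ (k\<^sup>2 + j) * of_bool (block_pos (k\<^sup>2 + j) < t))
        = z ^ k\<^sup>2 * (\<Sum>j<m. z ^ j)" by (simp add: sum_distrib_left)
    show "norm (\<Sum>j<2*k+1. z ^ (k\<^sup>2 + j) * of_bool (block_pos (k\<^sup>2 + j) < t) - L)
            \<le> max 1 (2 / norm (z - 1))"
    proof (cases "z = 1")
      case True
      have "(\<Sum>j<2*k+1. z ^ (k\<^sup>2 + j) * of_bool (block_pos (k\<^sup>2 + j) < t) - L)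
          = of_real (real m - t * real (2*k+1))"
        unfolding sum_subtractf sum by (simp add: True L_def algebra_simps)
      then show ?thesis using mt by (simp only: norm_of_real)
    next
      case False
      have "norm (\<Sum>j<2*k+1. z ^ (k\<^sup>2 + j) * of_bool (block_pos (k\<^sup>2 + j) < t) - L)
          = norm (z ^ m - 1) / norm (z - 1)"
        unfolding sum_subtractf sum
        by (simp add: False L_def geometric_sum norm_mult norm_power norm_divide z)
      also have "\<dots> \<le> 2 / norm (z - 1)"
        using norm_triangle_ineq4[of "z ^ m" 1] by (intro divide_right_mono) (simp_all add: norm_power z)
      finally show ?thesis by simp
    qed
  qed
  then have "(\<lambda>N. (\<Sum>n<N. z ^ n * of_bool (block_pos n < t) - L) / of_nat N + L) \<longlonglongrightarrow> 0 + L"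
    by (intro tendsto_intros)
  moreover have "eventually (\<lambda>N. (\<Sum>n<N. z ^ n * of_bool (block_pos n < t) - L) / of_nat N + L
      = (\<Sum>n<N. z ^ n * of_bool (block_pos n < t)) / of_nat N) sequentially"
    by (rule eventually_sequentiallyI[of 1]) (simp add: sum_subtractf field_simps)
  ultimately show ?thesis
    unfolding L_def[symmetric] add_0 by (rule Lim_transform_eventually)
qed

section \<open>A sequence of labels with prescribed frequencies\<close>

text \<open>
  The quantile function of the distribution \<open>p\<close>, evaluated at \<open>block_pos n\<close>.
\<close>

definition label :: "(nat \<Rightarrow> real) \<Rightarrow> nat \<Rightarrow> nat"
  where "label p n = (LEAST c. block_pos n < (\<Sum>i=1..c. p i))"

lemma label_le_iff:
  assumes "\<And>i. 0 \<le> p i" and "(\<Sum>i=1..q. p i) = 1"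
  shows "label p n \<le> c \<longleftrightarrow> block_pos n < (\<Sum>i=1..c. p i)"
proof
  assume "label p n \<le> c"
  have "block_pos n < (\<Sum>i=1..q. p i)" using assms(2) block_pos_less_1 by simp
  then have "block_pos n < (\<Sum>i=1..label p n. p i)"
    unfolding label_def by (rule LeastI)
  also have "\<dots> \<le> (\<Sum>i=1..c. p i)"
    using \<open>label p n \<le> c\<close> assms(1) by (intro sum_mono2) auto
  finally show "block_pos n < (\<Sum>i=1..c. p i)" .
qed (auto simp: label_def intro: Least_le)

lemma label_range:
  assumes "\<And>i. 0 \<le> p i" and "(\<Sum>i=1..q. p i) = 1"
  shows "label p n \<in> {1..q}"
proof -
  have "label p n \<le> q" using label_le_iff[OF assms] assms(2) block_pos_less_1 by simp
  moreover have "\<not> label p n \<le> 0"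
    unfolding label_le_iff[OF assms] using block_pos_nonneg[of n] by simp
  ultimately show ?thesis by auto
qed

text \<open>
  The event that the label is \<open>c\<close> is the difference of the events that it is at most \<open>c\<close> and at
  most \<open>c - 1\<close>. Both are threshold conditions on \<open>block_pos\<close>, with thresholds that differ by \<open>p c\<close>.
\<close>

lemma label_average:
  fixes z :: complex and w :: "nat \<Rightarrow> complex"
  assumes p: "\<And>i. 0 \<le> p i" "(\<Sum>i=1..q. p i) = 1" and z: "norm z = 1"
  shows "(\<lambda>N. (\<Sum>n<N. z ^ n * w (label p n)) / of_nat N)
           \<longlonglongrightarrow> (if z = 1 then \<Sum>c=1..q. of_real (p c) * w c else 0)"
proof -
  define P where "P c = (\<Sum>i=1..c. p i)" for c
  define A where "A c N = (\<Sum>n<N. z ^ n * of_bool (block_pos n < P c)) / of_nat N" for c N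
  have lab: "w (label p n) = (\<Sum>c=1..q. w c * (of_bool (block_pos n < P c) - of_bool (block_pos n < P (c-1))))"
    for n
  proof -
    have "(\<Sum>c=1..q. w c * (of_bool (block_pos n < P c) - of_bool (block_pos n < P (c-1))))
        = (\<Sum>c=1..q. if c = label p n then w c else 0)"
      unfolding P_def label_le_iff[OF p, symmetric] by (intro sum.cong) auto
    also have "\<dots> = w (label p n)"
      using label_range[OF p, of n] by (subst sum.delta) auto
    finally show ?thesis by simp
  qed
  have avg: "(\<Sum>n<N. z ^ n * w (label p n)) / of_nat N = (\<Sum>c=1..q. w c * (A c N - A (c-1) N))" for N
  proof -
    have "(\<Sum>n<N. z ^ n * w (label p n))
        = (\<Sum>c=1..q. \<Sum>n<N. w c * (z ^ n * of_bool (block_pos n < P c) - z ^ n * of_bool (block_pos n < P (c-1))))"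
      unfolding lab sum_distrib_left by (subst sum.swap) (simp add: algebra_simps)
    also have "\<dots> / of_nat N = (\<Sum>c=1..q. w c * (A c N - A (c-1) N))"
      unfolding sum_divide_distrib[of _ "{1..q}"] A_def diff_divide_distrib[symmetric]
        sum_subtractf[symmetric] sum_distrib_left[symmetric] times_divide_eq_right ..
    finally show ?thesis .
  qed
  have P: "0 \<le> P c" "P c \<le> 1" if "c \<le> q" for c
  proof -
    show "0 \<le> P c" unfolding P_def by (intro sum_nonneg p)
    have "P c \<le> P q" unfolding P_def using that p by (intro sum_mono2) auto
    then show "P c \<le> 1" using p by (simp add: P_def)
  qed
  have A: "A c \<longlonglongrightarrow> (if z = 1 then of_real (P c) else 0)" if "c \<le> q" for c
    unfolding A_def using that by (intro threshold_average z P)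
  have "(\<lambda>N. \<Sum>c=1..q. w c * (A c N - A (c-1) N)) \<longlonglongrightarrow>
      (\<Sum>c=1..q. w c * ((if z = 1 then of_real (P c) else 0) - (if z = 1 then of_real (P (c-1)) else 0)))"
    by (intro tendsto_sum tendsto_mult tendsto_const tendsto_diff A) auto
  also have "(\<Sum>c=1..q. w c * ((if z = 1 then of_real (P c) else 0) - (if z = 1 then of_real (P (c-1)) else 0)))
      = (if z = 1 then \<Sum>c=1..q. of_real (p c) * w c else 0)"
  proof -
    have "P c - P (c-1) = p c" if "c \<in> {1..q}" for c
      using that by (cases c) (simp_all add: P_def)
    then have "w c * (of_real (P c) - of_real (P (c-1))) = of_real (p c) * w c" if "c \<in> {1..q}" for c
      using that by (simp only: of_real_diff[symmetric] mult.commute)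
    then show ?thesis by (auto intro!: sum.cong)
  qed
  finally show ?thesis unfolding avg .
qed

section \<open>Sets, circle points and measures with finite support\<close>

text \<open>
  Two increasing sequences with the same range dominate each other: each is the other one
  composed with a strictly increasing map of indices, and such a map lies above the identity.
\<close>

lemma enumerate_range_strict_mono:
  fixes f :: "nat \<Rightarrow> nat"
  assumes f: "strict_mono f"
  shows "enumerate (range f) n = f n"
proof -
  let ?S = "range f"
  have inf: "infinite ?S"
    using f by (simp add: range_inj_infinite strict_mono_imp_inj_on)
  have E: "strict_mono (enumerate ?S)" "range (enumerate ?S) = ?S"
    by (simp_all add: inf strict_mono_enumerate range_enumerate)
  have *: "g n \<le> h n" if g: "strict_mono g" and h: "strict_mono h" and sub: "range h \<subseteq> range g"
    for g h :: "nat \<Rightarrow> nat" and n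
  proof -
    have "\<exists>m. h n = g m" for n using sub by blast
    then obtain k where k: "\<And>n. h n = g (k n)" by metis
    have "strict_mono k"
      using h g by (simp add: strict_mono_def[of k] strict_mono_def[of h] k strict_mono_less[OF g])
    then have "n \<le> k n" by (rule strict_mono_imp_increasing)
    then show ?thesis using g by (simp add: k strict_mono_less_eq)
  qed
  show ?thesis
    by (rule antisym; rule *[of "enumerate ?S" f] *[of f "enumerate ?S"]) (simp_all add: f E)
qed

lemma e_add: "e (x + y) = e x * e y"
  by (simp add: e_def exp_add[symmetric] algebra_simps)

lemma e_of_nat_mult: "e (real n * x) = e x ^ n"
  by (simp add: e_def exp_of_nat_mult[symmetric] algebra_simps)

lemma norm_e: "norm (e x) = 1"
  by (simp add: e_def)

lemma singleton_circle_borel: "{x :: circle} \<in> sets borel"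
proof -
  have "closed (circle_e -` {circle_e x})"
    using continuous_on_circle_e continuous_on_closed_vimage[of UNIV circle_e] by simp
  also have "circle_e -` {circle_e x} = {x}" using inj_circle_e by (auto simp: inj_def)
  finally show ?thesis by simp
qed

lemma integral_empirical:
  fixes f :: "circle \<Rightarrow> real"
  assumes "continuous_on UNIV f"
  shows "(\<integral>x. f x \<partial>empirical S \<alpha> N) = (\<Sum>n<N. f (mod1 (real (enumerate S n) * \<alpha>))) / real N"
proof -
  have [measurable]: "f \<in> borel_measurable borel"
    using assms by (rule borel_measurable_continuous_onI)
  have "(\<lambda>n. mod1 (real (enumerate S n) * \<alpha>)) \<in> uniform_count_measure {..<N} \<rightarrow>\<^sub>M borel"
    by (auto simp: measurable_def space_uniform_count_measure)
  then show ?thesis unfolding empirical_def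
    by (subst integral_distr) (auto simp: integral_uniform_count_measure)
qed

lemma integral_finite_support:
  fixes f :: "'a \<Rightarrow> real"
  assumes "prob_space M" and "finite X" and "\<And>x. x \<in> X \<Longrightarrow> {x} \<in> sets M" and "measure M X = 1"
    and [measurable]: "f \<in> borel_measurable M"
  shows "(\<integral>x. f x \<partial>M) = (\<Sum>x\<in>X. measure M {x} * f x)"
proof -
  interpret prob_space M by fact
  have X: "X \<in> sets M" using assms(4) measure_notin_sets by fastforce
  then have AE: "AE x in M. x \<in> X" using assms(4) by (simp add: prob_eq_1)
  have "(\<integral>x. f x \<partial>M) = (\<integral>x. (\<Sum>y\<in>X. indicator {y} x * f y) \<partial>M)"
  proof (rule integral_cong_AE)
    show "AE x in M. f x = (\<Sum>y\<in>X. indicator {y} x * f y)"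
      using AE
    proof eventually_elim
      case (elim x)
      have "(\<Sum>y\<in>X. indicator {y} x * f y) = (\<Sum>y\<in>X. if y = x then f y else 0)"
        by (intro sum.cong) (auto simp: indicator_def)
      with elim assms(2) show ?case by (simp add: sum.delta)
    qed
  qed (use assms(3) in \<open>auto intro!: borel_measurable_sum borel_measurable_times borel_measurable_indicator\<close>)
  also have "\<dots> = (\<Sum>y\<in>X. \<integral>x. indicator {y} x * f y \<partial>M)"
    by (rule Bochner_Integration.integral_sum)
       (use assms(3) in \<open>auto intro!: integrable_mult_left integrable_real_indicator simp: emeasure_eq_measure\<close>)
  also have "\<dots> = (\<Sum>y\<in>X. measure M {y} * f y)"
    using assms(3) by (intro sum.cong) (auto simp: Int_absorb2 sets.sets_into_space)
  finally show ?thesis .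
qed

lemma mod1_fraction_eq_iff:
  assumes "q > 0"
  shows "mod1 (real i / real q) = mod1 (real j / real q) \<longleftrightarrow> [i = j] (mod q)"
proof -
  have "mod1 (real i / real q) = mod1 (real j / real q) \<longleftrightarrow> (\<exists>k::int. real i - real j = of_int k * real q)"
    using assms by (simp add: mod1_eq_iff Ints_def image_iff divide_eq_eq flip: diff_divide_distrib)
  also have "\<dots> \<longleftrightarrow> (\<exists>k::int. int i - int j = k * int q)"
  proof (intro iff_exI)
    fix k :: int
    have "real i - real j = of_int k * real q \<longleftrightarrow> real_of_int (int i - int j) = of_int (k * int q)"
      by simp
    then show "real i - real j = of_int k * real q \<longleftrightarrow> int i - int j = k * int q"
      by (simp only: of_int_eq_iff)
  qed
  also have "\<dots> \<longleftrightarrow> [int i = int j] (mod int q)"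
    by (auto simp: cong_iff_dvd_diff dvd_def mult.commute)
  finally show ?thesis by (simp add: cong_int_iff)
qed

section \<open>The set with the prescribed labels as residues\<close>

theorem mainTheorem1:
  fixes q a :: nat and \<nu> :: "circle measure"
  assumes "q > 0" and "a > 0" and "coprime a q"
    and "prob_space \<nu>" and "sets \<nu> = sets borel"
    and "measure \<nu> {mod1 (real b / real q) | b. b \<in> {1..q}} = 1"
  shows "\<exists>S :: nat set. represents S (real a / real q) \<nu>"
proof -
  define x where "x c = mod1 (real (c * a) / real q)" for c
  define X where "X = {mod1 (real b / real q) | b. b \<in> {1..q}}"
  define p where "p c = measure \<nu> {x c}" for c
  have inj: "inj_on x {1..q}"
  proof (rule inj_onI)
    fix c d assume "c \<in> {1..q}" "d \<in> {1..q}" "x c = x d"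
    then have "[c = d] (mod q)"
      using assms(1,3) by (simp add: x_def mod1_fraction_eq_iff cong_mult_rcancel_nat
          del: of_nat_mult)
    with \<open>c \<in> {1..q}\<close> \<open>d \<in> {1..q}\<close> show "c = d"
      by (cases "c = q"; cases "d = q") (auto simp: cong_def)
  qed
  have X_image: "X = (\<lambda>b. mod1 (real b / real q)) ` {1..q}" by (auto simp: X_def)
  have "finite X" by (simp add: X_image)
  \<comment> \<open>By counting, injectivity makes the multiples of \<open>a / q\<close> exhaust the fractions \<open>b / q\<close>.\<close>
  have xX: "x ` {1..q} = X"
  proof (rule card_seteq[OF \<open>finite X\<close>])
    show "x ` {1..q} \<subseteq> X"
    proof
      fix y assume "y \<in> x ` {1..q}"
      then obtain c where c: "y = x c" by auto
      \<comment> \<open>The residue \<open>0\<close> is represented by \<open>q\<close>, because the fractions are indexed by \<open>{1..q}\<close>.\<close>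
      define b where "b = (if c * a mod q = 0 then q else c * a mod q)"
      have "b \<in> {1..q}" "[c * a = b] (mod q)"
        using assms(1) by (auto simp: b_def cong_def less_imp_le)
      then show "y \<in> X"
        using assms(1) unfolding X_image c x_def by (auto simp: mod1_fraction_eq_iff simp del: of_nat_mult)
    qed
    show "card X \<le> card (x ` {1..q})"
      unfolding X_image card_image[OF inj] by (rule card_image_le) simp
  qed
  have sing: "{y} \<in> sets \<nu>" for y using singleton_circle_borel assms(5) by simp
  have integral: "(\<integral>y. f y \<partial>\<nu>) = (\<Sum>c=1..q. p c * f (x c))"
    if "f \<in> borel_measurable borel" for f :: "circle \<Rightarrow> real"
  proof -
    have "f \<in> borel_measurable \<nu>" using that assms(5) measurable_cong_sets by blast
    then have "(\<integral>y. f y \<partial>\<nu>) = (\<Sum>y\<in>X. measure \<nu> {y} * f y)"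
      using assms(4,6) \<open>finite X\<close> sing by (intro integral_finite_support) (auto simp: X_def)
    then show ?thesis
      unfolding xX[symmetric] sum.reindex[OF inj] by (simp add: p_def)
  qed
  interpret \<nu>: prob_space \<nu> by fact
  \<comment> \<open>The weights sum to the integral of the constant function \<open>1\<close>.\<close>
  have p: "\<And>c. 0 \<le> p c" "(\<Sum>c=1..q. p c) = 1"
    using integral[of "\<lambda>_. 1"] by (simp_all add: p_def \<nu>.prob_space)

  define s where "s n = q * n + label p n" for n
  have label: "label p n \<in> {1..q}" for n using p by (rule label_range)
  have mono: "strict_mono s"
  proof (rule strict_mono_Suc_iff[THEN iffD2], rule allI)
    \<comment> \<open>Both labels lie in \<open>{1..q}\<close>, so they differ by less than \<open>q\<close>.\<close>
    fix n show "s n < s (Suc n)"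
      using label[of n] label[of "Suc n"] by (simp add: s_def)
  qed
  define S where "S = range s"
  have enum: "enumerate S n = s n" for n
    unfolding S_def using mono by (rule enumerate_range_strict_mono)
  have "infinite S"
    unfolding S_def using mono by (simp add: range_inj_infinite strict_mono_imp_inj_on)
  moreover have "0 \<notin> S"
  proof -
    have "s n \<noteq> 0" for n using label[of n] by (simp add: s_def)
    then show ?thesis unfolding S_def by (metis rangeE)
  qed
  moreover have "convergent (\<lambda>N. (\<Sum>n<N. e (real (enumerate S n) * \<alpha>)) / of_nat N)" for \<alpha>
  proof -
    have "e (real (enumerate S n) * \<alpha>) = e (real q * \<alpha>) ^ n * e (real (label p n) * \<alpha>)" for n
      unfolding enum s_def e_of_nat_mult[symmetric] e_add[symmetric] by (simp add: algebra_simps)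
    with label_average[OF p norm_e, of "real q * \<alpha>" "\<lambda>c. e (real c * \<alpha>)"]
    show ?thesis by (auto simp: convergent_def)
  qed
  ultimately have "good_set S" by (simp add: good_set_def)

  have pos: "mod1 (real (enumerate S n) * (real a / real q)) = x (label p n)" for n
  proof -
    have "[s n * a = label p n * a] (mod q)"
      unfolding s_def cong_def by (metis add_mult_distrib mod_mult_self4 mult.assoc)
    then show ?thesis
      using assms(1) unfolding x_def by (simp add: mod1_fraction_eq_iff[symmetric] enum)
  qed
  have "weak_limit (empirical S (real a / real q)) \<nu>"
    unfolding weak_limit_def
  proof (intro conjI allI impI)
    fix f :: "circle \<Rightarrow> real" assume f: "continuous_on UNIV f"
    have "(\<lambda>N. (\<Sum>n<N. 1 ^ n * complex_of_real (f (x (label p n)))) / of_nat N)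
        \<longlonglongrightarrow> (\<Sum>c=1..q. of_real (p c) * of_real (f (x c)))"
      using label_average[OF p, of 1 "\<lambda>c. of_real (f (x c))"] by simp
    then have "(\<lambda>N. complex_of_real ((\<Sum>n<N. f (x (label p n))) / real N))
        \<longlonglongrightarrow> complex_of_real (\<Sum>c=1..q. p c * f (x c))" by simp
    then have "(\<lambda>N. (\<Sum>n<N. f (x (label p n))) / real N) \<longlonglongrightarrow> (\<Sum>c=1..q. p c * f (x c))"
      by (simp only: tendsto_of_real_iff)
    then show "(\<lambda>N. \<integral>y. f y \<partial>empirical S (real a / real q) N) \<longlonglongrightarrow> (\<integral>y. f y \<partial>\<nu>)"
      unfolding integral_empirical[OF f] pos integral[OF borel_measurable_continuous_onI[OF f]] .
  qed (use assms in auto)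
  with \<open>good_set S\<close> show ?thesis
    unfolding represents_def using limit_measure_eqI by blast
qed

end
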